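(* Let $f:\mathbb{R}^n\to\mathbb{R}$ be twice differentiable and $\mu$-strongly convex for some $\mu>0$, let $g:\mathbb{R}^n\to(-\infty,\infty]$ be closed convex, let $\nu>0$, and let $x^*$ be the minimizer of $f+g$ (equivalently, $F_\nu(x^* )=0$). Suppose that the set-valued function $\partial F_\nu$ is a linear Newton approximation (LNA) of $F_\nu$ at $x^*$ and that, for every $x\in\mathbb{R}^n$, all elements of $\partial F_\nu(x)$ are nonsingular. Then every sequence $\{x^{(k)}\}_{k=1}^\infty$ generated by the linear Newton method converges locally superlinearly to $x^*$. Moreover, if $\partial F_\nu$ is a strong LNA of $F_\nu$ at $x^*$, then every sequence $\{x^{(k)}\}_{k=1}^\infty$ generated by the linear Newton method converges locally quadratically to $x^*$.
   Context: $\|\cdot\|_2$ is the Euclidean norm and $\|\cdot\|$ the operator norm on $\mathbb{R}^{n\times n}$. $f$ is $\mu$-strongly convex if $f((1-\lambda)x+\lambda y)\le(1-\lambda)f(x)+\lambda f(y)-\frac{\mu}{2}\lambda(1-\lambda)\|x-y\|_2^2$ for all $x,y$ and $0\le\lambda\le1$. $g$ closed means all sublevel sets are closed; $g$ is not identically $+\infty$. Proximal map: $\mathrm{prox}_{h}(x)=\mathrm{argmin}_{y}\{h(y)+\frac12\|y-x\|_2^2\}$. It is Lipschitz continuous with constant $1$ for closed convex $h$. B-subdifferential of a Lipschitz continuous $F:\mathbb{R}^n\to\mathbb{R}^n$ at $x$: $\partial_BF(x)$ is the set of $V\in\mathbb{R}^{n\times n}$ for which there is a sequence $z^{(k)}\to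 x$ of points at which $F$ is differentiable with $\nabla F(z^{(k)})\to V$ ($\nabla F$ denotes the Jacobian). Define $F_\nu(x)=x-\mathrm{prox}_{\nu g}(x-\nu\nabla f(x))$ and $$\partial F_\nu(x)=\{I-V(I-\nu\nabla^2f(x)) : V\in\partial_B\mathrm{prox}_{\nu g}(x-\nu\nabla f(x))\}.$$ LNA: for a continuous $F:\mathbb{R}^n\to\mathbb{R}^n$, a set-valued function $\mathcal{A}$ assigning to each $y\in\mathbb{R}^n$ a subset $\mathcal{A}(y)\subset\mathbb{R}^{n\times n}$ is an LNA of $F$ at $x$ if (i) every $\mathcal{A}(y)$ is compact; (ii) $\mathcal{A}$ is upper-semicontinuous at $x$: for every $\epsilon>0$ there is $\delta>0$ such that $\|x-y\|_2<\delta$ implies $\mathcal{A}(y)\subset\mathcal{A}(x)+\{A:\|A\|<\epsilon\}$; (iii) $\|F(x)-F(y)-A(x-y)\|_2=o(\|x-y\|_2)$ as $y\to x$, uniformly over $A\in\mathcal{A}(y)$. It is a strong LNA if in (iii) $o(\|x-y\|_2)$ is replaced by $O(\|x-y\|_2^2)$. Linear Newton method: given $x^{(1)}\in\mathbb{R}^n$, for $k=1,2,\dots$ choose any $V^{(k)}\in\partial_B\mathrm{prox}_{\nu g}(x^{(k)}-\nu\nabla f(x^{(k)}))$ and set $x^{(k+1)}=x^{(k)}+d^{(k)}$ with $d^{(k)}=-\left(I-V^{(k)}(I-\nu\nabla^2f(x^{(k)}))\right)^{-1}F_\nu(x^{(k)})$. Locally superlinear (resp. quadratic) convergence to $x^*$: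 there is $\epsilon>0$ such that whenever $\|x^{(1)}-x^*\|_2<\epsilon$, $x^{(k)}\to x^*$ and $\|x^{(k+1)}-x^*\|_2=o(\|x^{(k)}-x^*\|_2)$ (resp. $=O(\|x^{(k)}-x^*\|_2^2)$) as $k\to\infty$. *)

theory Defs
  imports "HOL-Analysis.Analysis" "HOL-Library.Landau_Symbols"
begin

text \<open>Gradient and Hessian are meaningful only where the derivatives in question exist; the
  Hessian is the Jacobian matrix of the gradient.\<close>

definition gradient :: "(real ^ 'n \<Rightarrow> real) \<Rightarrow> real ^ 'n \<Rightarrow> real ^ 'n" where
  "gradient f x = (THE D. GDERIV f x :> D)"

definition hessian :: "(real ^ 'n \<Rightarrow> real) \<Rightarrow> real ^ 'n \<Rightarrow> real ^ 'n ^ 'n" where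
  "hessian f x = jacobian (gradient f) (at x)"

definition twice_differentiable :: "(real ^ 'n \<Rightarrow> real) \<Rightarrow> bool" where
  "twice_differentiable f \<longleftrightarrow>
     (\<forall>x. f differentiable at x) \<and> (\<forall>x. gradient f differentiable at x)"

definition strongly_convex :: "real \<Rightarrow> (real ^ 'n \<Rightarrow> real) \<Rightarrow> bool" where
  "strongly_convex \<mu> f \<longleftrightarrow>
     (\<forall>x y. \<forall>l\<in>{0..1}.
        f ((1 - l) *\<^sub>R x + l *\<^sub>R y)
          \<le> (1 - l) * f x + l * f y - \<mu> / 2 * l * (1 - l) * (norm (x - y))\<^sup>2)"

text \<open>Closed convex functions with values in the extended reals without minus infinity, not
  identically plus infinity.  At \<open>l = 0\<close> and \<open>l = 1\<close> the convexity inequality relies on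
  \<open>0 * \<infinity> = 0\<close> in type \<^typ>\<open>ereal\<close> and is trivial.\<close>

definition closed_convex_function :: "(real ^ 'n \<Rightarrow> ereal) \<Rightarrow> bool" where
  "closed_convex_function g \<longleftrightarrow>
     (\<forall>x. g x \<noteq> - \<infinity>) \<and> (\<exists>x. g x \<noteq> \<infinity>) \<and>
     (\<forall>c::real. closed {x. g x \<le> ereal c}) \<and>
     (\<forall>x y. \<forall>l\<in>{0..1}.
        g ((1 - l) *\<^sub>R x + l *\<^sub>R y) \<le> ereal (1 - l) * g x + ereal l * g y)"

definition prox :: "(real ^ 'n \<Rightarrow> ereal) \<Rightarrow> real ^ 'n \<Rightarrow> real ^ 'n" where
  "prox h x = (ARG_MIN (\<lambda>y. h y + ereal (1 / 2 * (norm (y - x))\<^sup>2)) y. True)"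

definition B_subdifferential ::
  "(real ^ 'n \<Rightarrow> real ^ 'n) \<Rightarrow> real ^ 'n \<Rightarrow> (real ^ 'n ^ 'n) set" where
  "B_subdifferential F x =
     {V. \<exists>z. z \<longlonglongrightarrow> x \<and> (\<forall>k. F differentiable at (z k)) \<and>
             (\<lambda>k. jacobian F (at (z k))) \<longlonglongrightarrow> V}"

definition prox_residual ::
  "(real ^ 'n \<Rightarrow> real) \<Rightarrow> (real ^ 'n \<Rightarrow> ereal) \<Rightarrow> real \<Rightarrow> real ^ 'n \<Rightarrow> real ^ 'n" where
  "prox_residual f g \<nu> x = x - prox (\<lambda>y. ereal \<nu> * g y) (x - \<nu> *\<^sub>R gradient f x)"

definition newton_matrix ::
  "(real ^ 'n \<Rightarrow> real) \<Rightarrow> real \<Rightarrow> real ^ 'n \<Rightarrow> real ^ 'n ^ 'n \<Rightarrow> real ^ 'n ^ 'n" where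
  "newton_matrix f \<nu> x V = mat 1 - V ** (mat 1 - \<nu> *\<^sub>R hessian f x)"

definition prox_residual_subdiff ::
  "(real ^ 'n \<Rightarrow> real) \<Rightarrow> (real ^ 'n \<Rightarrow> ereal) \<Rightarrow> real \<Rightarrow> real ^ 'n \<Rightarrow> (real ^ 'n ^ 'n) set" where
  "prox_residual_subdiff f g \<nu> x =
     {newton_matrix f \<nu> x V | V.
        V \<in> B_subdifferential (prox (\<lambda>y. ereal \<nu> * g y)) (x - \<nu> *\<^sub>R gradient f x)}"

text \<open>The library norm on matrices is not the operator norm, hence the explicit \<^const>\<open>onorm\<close>.\<close>

definition usc_at ::
  "(real ^ 'n \<Rightarrow> (real ^ 'n ^ 'n) set) \<Rightarrow> real ^ 'n \<Rightarrow> bool" where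
  "usc_at \<A> x \<longleftrightarrow>
     (\<forall>\<epsilon>>0. \<exists>\<delta>>0. \<forall>y. norm (x - y) < \<delta> \<longrightarrow>
        \<A> y \<subseteq> {B + E | B E. B \<in> \<A> x \<and> onorm ((*v) E) < \<epsilon>})"

definition LNA ::
  "(real ^ 'n \<Rightarrow> real ^ 'n) \<Rightarrow> (real ^ 'n \<Rightarrow> (real ^ 'n ^ 'n) set) \<Rightarrow> real ^ 'n \<Rightarrow> bool" where
  "LNA F \<A> x \<longleftrightarrow>
     (\<forall>y. compact (\<A> y)) \<and> usc_at \<A> x \<and>
     (\<forall>c>0. \<forall>\<^sub>F y in at x. \<forall>A\<in>\<A> y.
        norm (F x - F y - A *v (x - y)) \<le> c * norm (x - y))"

definition strong_LNA ::
  "(real ^ 'n \<Rightarrow> real ^ 'n) \<Rightarrow> (real ^ 'n \<Rightarrow> (real ^ 'n ^ 'n) set) \<Rightarrow> real ^ 'n \<Rightarrow> bool" where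
  "strong_LNA F \<A> x \<longleftrightarrow>
     (\<forall>y. compact (\<A> y)) \<and> usc_at \<A> x \<and>
     (\<exists>C. \<forall>\<^sub>F y in at x. \<forall>A\<in>\<A> y.
        norm (F x - F y - A *v (x - y)) \<le> C * (norm (x - y))\<^sup>2)"

text \<open>Iterates are numbered from 1; the entry with index 0 is irrelevant.\<close>

definition linear_newton_sequence ::
  "(real ^ 'n \<Rightarrow> real) \<Rightarrow> (real ^ 'n \<Rightarrow> ereal) \<Rightarrow> real \<Rightarrow> (nat \<Rightarrow> real ^ 'n) \<Rightarrow> bool" where
  "linear_newton_sequence f g \<nu> x \<longleftrightarrow>
     (\<forall>k\<ge>1. \<exists>V \<in> B_subdifferential (prox (\<lambda>y. ereal \<nu> * g y))
                    (x k - \<nu> *\<^sub>R gradient f (x k)).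
        x (Suc k) = x k + - (matrix_inv (newton_matrix f \<nu> (x k) V) *v prox_residual f g \<nu> (x k)))"

text \<open>Local convergence of all sequences in a class \<open>S\<close>, with a radius that does not depend on the
  sequence.\<close>

definition locally_superlinearly_convergent ::
  "(nat \<Rightarrow> real ^ 'n) set \<Rightarrow> real ^ 'n \<Rightarrow> bool" where
  "locally_superlinearly_convergent S xs \<longleftrightarrow>
     (\<exists>\<epsilon>>0. \<forall>x\<in>S. norm (x 1 - xs) < \<epsilon> \<longrightarrow>
        x \<longlonglongrightarrow> xs \<and>
        (\<lambda>k. norm (x (Suc k) - xs)) \<in> o(\<lambda>k. norm (x k - xs)))"

definition locally_quadratically_convergent ::
  "(nat \<Rightarrow> real ^ 'n) set \<Rightarrow> real ^ 'n \<Rightarrow> bool" where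
  "locally_quadratically_convergent S xs \<longleftrightarrow>
     (\<exists>\<epsilon>>0. \<forall>x\<in>S. norm (x 1 - xs) < \<epsilon> \<longrightarrow>
        x \<longlonglongrightarrow> xs \<and>
        (\<lambda>k. norm (x (Suc k) - xs)) \<in> O(\<lambda>k. (norm (x k - xs))\<^sup>2))"

end

theory Submission
  imports Defs
begin

text \<open>
  Two facts make the theorem true.

  First, \<open>xstar\<close> is a zero of the residual.  Differentiating \<open>f + g\<close> along the segment from
  \<open>xstar\<close> to \<open>y\<close> gives the variational inequality
  \<open>g xstar \<le> g y + \<nabla>f xstar \<bullet> (y - xstar)\<close> (lemma \<open>minimizer_variational_inequality\<close>).  Expanding
  the square in the objective that defines the proximal point of \<open>xstar - \<nu> \<nabla>f xstar\<close>, the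
  inequality says that \<open>y\<close> exceeds \<open>xstar\<close> in that objective by at least
  \<open>(norm (y - xstar))\<^sup>2 / 2\<close>, so \<open>xstar\<close> is its only minimizer
  (lemma \<open>prox_residual_minimizer\<close>).

  Second, a Newton step from \<open>y\<close> with a matrix \<open>A\<close> leads to a point \<open>z\<close> for which
  \<open>A (z - xstar) = F xstar - F y - A (xstar - y)\<close>, because \<open>F xstar = 0\<close>.  The right-hand side is
  exactly the error that a linear Newton approximation controls.  To transfer this control to
  \<open>z - xstar\<close> one needs a bound \<open>m * norm v \<le> norm (A v)\<close> with \<open>m > 0\<close> independent of \<open>A\<close> and
  of \<open>y\<close> near \<open>xstar\<close>.  At \<open>xstar\<close> it follows from nonsingularity by compactness, and upper
  semicontinuity spreads it to a neighbourhood at the price of half the constant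
  (lemma \<open>usc_uniformly_bounded_below\<close>).  An error \<open>o(norm (y - xstar))\<close> then makes the iteration a
  contraction near \<open>xstar\<close> with a factor that tends to zero, and a quadratic error gives quadratic
  convergence.
\<close>

section \<open>Newton steps with linear Newton approximations\<close>

text \<open>The set-valued function \<open>\<A>\<close> need not come from a proximal map: the convergence argument only
  sees an equation \<open>F x = 0\<close> and the matrices offered by \<open>\<A>\<close>.\<close>

definition newton_sequence ::
  "(real ^ 'n \<Rightarrow> real ^ 'n) \<Rightarrow> (real ^ 'n \<Rightarrow> (real ^ 'n ^ 'n) set) \<Rightarrow> (nat \<Rightarrow> real ^ 'n) \<Rightarrow> bool" where
  "newton_sequence F \<A> x \<longleftrightarrow>
     (\<forall>k\<ge>1. \<exists>A\<in>\<A> (x k). x (Suc k) = x k - matrix_inv A *v F (x k))"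

lemma invertible_if_bounded_below:
  fixes A :: "real ^ 'n ^ 'n"
  assumes "m > 0" and "\<And>v. m * norm v \<le> norm (A *v v)"
  shows "invertible A"
proof -
  have "v = 0" if "A *v v = 0" for v
    using assms(2)[of v] that \<open>m > 0\<close> by (simp add: mult_le_0_iff)
  then show ?thesis
    by (metis invertible_left_inverse matrix_left_invertible_ker)
qed

text \<open>The product of the compact set of matrices with the unit sphere is compact, and on it
  the continuous function \<open>norm (A v)\<close> has no zero.\<close>

lemma compact_invertible_bounded_below:
  fixes S :: "(real ^ 'n ^ 'n) set"
  assumes "compact S" and inv: "\<And>A. A \<in> S \<Longrightarrow> invertible A"
  obtains m where "m > 0" and "\<And>A v. A \<in> S \<Longrightarrow> m * norm v \<le> norm (A *v v)"
proof (cases "S = {}")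
  case True
  then show thesis using that[of 1] by simp
next
  case False
  let ?K = "S \<times> sphere (0 :: real ^ 'n) 1"
  let ?h = "\<lambda>p :: (real ^ 'n ^ 'n) \<times> (real ^ 'n). norm (fst p *v snd p)"
  have "compact ?K"
    using \<open>compact S\<close> by (intro compact_Times) auto
  moreover have "?K \<noteq> {}"
    using False by simp
  moreover have "continuous_on ?K ?h"
    unfolding matrix_vector_mult_def by (intro continuous_intros)
  ultimately obtain p where p: "p \<in> ?K" and p_min: "\<And>q. q \<in> ?K \<Longrightarrow> ?h p \<le> ?h q"
    using continuous_attains_inf[of ?K ?h] by blast
  have unit: "norm (snd p) = 1" and "invertible (fst p)"
    using p inv by auto
  then have "?h p > 0"
    using matrix_left_invertible_ker[of "fst p"] invertible_left_inverse[of "fst p"] by force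
  moreover have "?h p * norm v \<le> norm (A *v v)" if "A \<in> S" for A v
  proof (cases "v = 0")
    case False
    have "?h p \<le> norm (A *v (v /\<^sub>R norm v))"
      using p_min[of "(A, v /\<^sub>R norm v)"] that False by simp
    also have "\<dots> = norm (A *v v) / norm v"
      by (simp add: matrix_vector_mult_scaleR divide_inverse mult.commute)
    finally show ?thesis
      using False by (simp add: field_simps)
  qed simp
  ultimately show thesis by (rule that)
qed

text \<open>A perturbation of operator norm less than \<open>m / 2\<close> costs at most half of the lower bound
  \<open>m\<close> that holds at the centre.\<close>

lemma usc_uniformly_bounded_below:
  fixes \<A> :: "real ^ 'n \<Rightarrow> (real ^ 'n ^ 'n) set"
  assumes "compact (\<A> x)" and "usc_at \<A> x" and "\<And>A. A \<in> \<A> x \<Longrightarrow> invertible A"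
  obtains m where "m > 0"
    and "\<forall>\<^sub>F y in nhds x. \<forall>A\<in>\<A> y. \<forall>v. m * norm v \<le> norm (A *v v)"
proof -
  obtain m where m: "m > 0" and low: "\<And>B v. B \<in> \<A> x \<Longrightarrow> m * norm v \<le> norm (B *v v)"
    using compact_invertible_bounded_below assms(1,3) by metis
  from \<open>usc_at \<A> x\<close> m obtain \<delta> where "\<delta> > 0"
    and \<delta>: "\<And>y. norm (x - y) < \<delta> \<Longrightarrow> \<A> y \<subseteq> {B + E | B E. B \<in> \<A> x \<and> onorm ((*v) E) < m / 2}"
    unfolding usc_at_def by (meson half_gt_zero)
  have "m / 2 * norm v \<le> norm (A *v v)" if near: "dist y x < \<delta>" and "A \<in> \<A> y" for y A v
  proof -
    from near have "norm (x - y) < \<delta>"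
      by (simp add: dist_norm norm_minus_commute)
    with \<delta> \<open>A \<in> \<A> y\<close> obtain B E where A: "A = B + E" and "B \<in> \<A> x"
      and E: "onorm ((*v) E) < m / 2"
      by blast
    have "norm (E *v v) \<le> onorm ((*v) E) * norm v"
      by (rule onorm) (rule matrix_vector_mul_bounded_linear)
    also have "\<dots> \<le> m / 2 * norm v"
      using E by (intro mult_right_mono) auto
    finally have "norm (E *v v) \<le> m / 2 * norm v" .
    moreover have "norm (B *v v) \<le> norm (A *v v) + norm (E *v v)"
      using norm_triangle_ineq4[of "A *v v" "E *v v"]
      by (simp add: A matrix_vector_mult_add_rdistrib)
    ultimately show ?thesis
      using low[OF \<open>B \<in> \<A> x\<close>, of v] by linarith
  qed
  then have "\<forall>\<^sub>F y in nhds x. \<forall>A\<in>\<A> y. \<forall>v. m / 2 * norm v \<le> norm (A *v v)"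
    unfolding eventually_nhds_metric using \<open>\<delta> > 0\<close> by blast
  with m show thesis
    by (intro that[of "m / 2"]) simp_all
qed

lemma matrix_inv_right:
  fixes A :: "real ^ 'n ^ 'n"
  assumes "invertible A"
  shows "A ** matrix_inv A = mat 1"
  using assms unfolding invertible_def matrix_inv_def by (metis (mono_tags, lifting) someI_ex)

lemma newton_step_error:
  fixes F :: "real ^ 'n \<Rightarrow> real ^ 'n"
  assumes "invertible A" and "F xs = 0" and z: "z = y - matrix_inv A *v F y"
  shows "A *v (z - xs) = F xs - F y - A *v (xs - y)"
proof -
  have "A *v (matrix_inv A *v F y) = F y"
    using \<open>invertible A\<close> by (simp add: matrix_vector_mul_assoc matrix_inv_right)
  then show ?thesis
    using \<open>F xs = 0\<close> by (simp add: z matrix_vector_mult_diff_distrib)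
qed

text \<open>Any error estimate \<open>e\<close> for the approximation passes to the Newton step up to a constant
  factor \<open>C\<close>, which does not depend on the estimate.  The requirement \<open>e xs \<ge> 0\<close> covers a step that
  starts at the solution: the estimate is only available on a punctured neighbourhood, but there
  the error is zero.\<close>

lemma newton_step_bound:
  fixes F :: "real ^ 'n \<Rightarrow> real ^ 'n"
  assumes "compact (\<A> xs)" and "usc_at \<A> xs" and "\<And>A. A \<in> \<A> xs \<Longrightarrow> invertible A"
    and "F xs = 0"
  obtains C where "C > 0"
    and "\<And>e :: real ^ 'n \<Rightarrow> real. e xs \<ge> 0 \<Longrightarrow>
           \<forall>\<^sub>F y in at xs. \<forall>A\<in>\<A> y. norm (F xs - F y - A *v (xs - y)) \<le> e y \<Longrightarrow>
           \<forall>\<^sub>F y in nhds xs. \<forall>A\<in>\<A> y. norm (y - matrix_inv A *v F y - xs) \<le> C * e y"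
proof -
  obtain m where m: "m > 0"
    and low: "\<forall>\<^sub>F y in nhds xs. \<forall>A\<in>\<A> y. \<forall>v. m * norm v \<le> norm (A *v v)"
    using usc_uniformly_bounded_below[of \<A> xs, OF assms(1-3)] by blast
  have "\<forall>\<^sub>F y in nhds xs. \<forall>A\<in>\<A> y. norm (y - matrix_inv A *v F y - xs) \<le> 1 / m * e y"
    if "e xs \<ge> 0"
      and err: "\<forall>\<^sub>F y in at xs. \<forall>A\<in>\<A> y. norm (F xs - F y - A *v (xs - y)) \<le> e y"
    for e :: "real ^ 'n \<Rightarrow> real"
  proof -
    have "\<forall>\<^sub>F y in nhds xs. \<forall>A\<in>\<A> y. norm (F xs - F y - A *v (xs - y)) \<le> e y"
      using err unfolding eventually_at_filter
      by (rule eventually_mono) (use \<open>e xs \<ge> 0\<close> in fastforce)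
    with low show ?thesis
    proof eventually_elim
      case (elim y)
      show ?case
      proof
        fix A assume "A \<in> \<A> y"
        let ?z = "y - matrix_inv A *v F y"
        have "invertible A"
          using invertible_if_bounded_below m elim(1) \<open>A \<in> \<A> y\<close> by blast
        then have "A *v (?z - xs) = F xs - F y - A *v (xs - y)"
          using newton_step_error[of A F xs] \<open>F xs = 0\<close> by blast
        then have "m * norm (?z - xs) \<le> e y"
          using elim \<open>A \<in> \<A> y\<close> by (metis order_trans)
        then show "norm (?z - xs) \<le> 1 / m * e y"
          using m by (simp add: field_simps)
      qed
    qed
  qed
  then show thesis
    using m by (intro that[of "1 / m"]) simp_all
qed

text \<open>A ball on which one step halves the distance to its centre \<open>xs\<close> traps the iterates.\<close>

lemma newton_sequence_locally_convergent:
  fixes F :: "real ^ 'n \<Rightarrow> real ^ 'n"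
  assumes "\<forall>\<^sub>F y in nhds xs. \<forall>A\<in>\<A> y. norm (y - matrix_inv A *v F y - xs) \<le> 1 / 2 * norm (y - xs)"
  obtains \<epsilon> where "\<epsilon> > 0"
    and "\<And>x. newton_sequence F \<A> x \<Longrightarrow> norm (x 1 - xs) < \<epsilon> \<Longrightarrow> x \<longlonglongrightarrow> xs"
proof -
  obtain \<epsilon> where "\<epsilon> > 0" and contr: "\<And>y A. norm (y - xs) < \<epsilon> \<Longrightarrow> A \<in> \<A> y \<Longrightarrow>
      norm (y - matrix_inv A *v F y - xs) \<le> 1 / 2 * norm (y - xs)"
    using assms unfolding eventually_nhds_metric dist_norm by blast
  have "x \<longlonglongrightarrow> xs" if x: "newton_sequence F \<A> x" and start: "norm (x 1 - xs) < \<epsilon>" for x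
  proof -
    have bound: "norm (x (Suc k) - xs) \<le> \<epsilon> * (1 / 2) ^ k \<and> norm (x (Suc k) - xs) < \<epsilon>" for k
    proof (induction k)
      case 0
      then show ?case using start by simp
    next
      case (Suc k)
      from x obtain A where "A \<in> \<A> (x (Suc k))"
        and "x (Suc (Suc k)) = x (Suc k) - matrix_inv A *v F (x (Suc k))"
        unfolding newton_sequence_def by force
      then have "norm (x (Suc (Suc k)) - xs) \<le> 1 / 2 * norm (x (Suc k) - xs)"
        using contr Suc.IH by simp
      moreover from this have "norm (x (Suc (Suc k)) - xs) \<le> norm (x (Suc k) - xs)"
        using norm_ge_zero[of "x (Suc k) - xs"] by linarith
      ultimately show ?case
        using Suc.IH by auto
    qed
    have "(\<lambda>k. \<epsilon> * (1 / 2) ^ k) \<longlonglongrightarrow> 0"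
      by (intro tendsto_mult_right_zero LIMSEQ_power_zero) simp
    then have "(\<lambda>k. x (Suc k) - xs) \<longlonglongrightarrow> 0"
      by (rule Lim_null_comparison[rotated]) (use bound in simp)
    then show ?thesis
      using LIM_zero_cancel LIMSEQ_Suc by (metis LIMSEQ_imp_Suc)
  qed
  with \<open>\<epsilon> > 0\<close> show thesis by (rule that)
qed

lemma newton_sequence_eventually_bound:
  fixes F :: "real ^ 'n \<Rightarrow> real ^ 'n" and e :: "real ^ 'n \<Rightarrow> real"
  assumes x: "newton_sequence F \<A> x" and lim: "x \<longlonglongrightarrow> xs"
    and step: "\<forall>\<^sub>F y in nhds xs. \<forall>A\<in>\<A> y. norm (y - matrix_inv A *v F y - xs) \<le> e y"
  shows "\<forall>\<^sub>F k in sequentially. norm (x (Suc k) - xs) \<le> e (x k)"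
  using eventually_compose_filterlim[OF step lim] eventually_ge_at_top[of 1]
proof eventually_elim
  case (elim k)
  from x elim(2) obtain A where "A \<in> \<A> (x k)" and "x (Suc k) = x k - matrix_inv A *v F (x k)"
    unfolding newton_sequence_def by blast
  with elim(1) show ?case by simp
qed

text \<open>With the constant \<open>C\<close> of \<open>newton_step_bound\<close>, an approximation error of
  \<open>c / C * norm (y - xs)\<close> makes one step contract by the factor \<open>c\<close>: the factor \<open>1 / 2\<close> gives
  convergence, arbitrarily small factors then give the rate.\<close>

theorem newton_locally_superlinear:
  fixes F :: "real ^ 'n \<Rightarrow> real ^ 'n"
  assumes "LNA F \<A> xs" and "\<And>A. A \<in> \<A> xs \<Longrightarrow> invertible A" and "F xs = 0"
  shows "locally_superlinearly_convergent {x. newton_sequence F \<A> x} xs"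
proof -
  have cpt: "compact (\<A> xs)" and usc: "usc_at \<A> xs"
    using assms(1) unfolding LNA_def by blast+
  obtain C where "C > 0" and C: "\<And>e :: real ^ 'n \<Rightarrow> real. e xs \<ge> 0 \<Longrightarrow>
       \<forall>\<^sub>F y in at xs. \<forall>A\<in>\<A> y. norm (F xs - F y - A *v (xs - y)) \<le> e y \<Longrightarrow>
       \<forall>\<^sub>F y in nhds xs. \<forall>A\<in>\<A> y. norm (y - matrix_inv A *v F y - xs) \<le> C * e y"
    using newton_step_bound[of \<A> xs F, OF cpt usc assms(2,3)] by blast
  have step: "\<forall>\<^sub>F y in nhds xs. \<forall>A\<in>\<A> y. norm (y - matrix_inv A *v F y - xs) \<le> c * norm (y - xs)"
    if "c > 0" for c
  proof -
    have "\<forall>\<^sub>F y in at xs. \<forall>A\<in>\<A> y.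
        norm (F xs - F y - A *v (xs - y)) \<le> c / C * norm (y - xs)"
      using assms(1) divide_pos_pos[OF \<open>c > 0\<close> \<open>C > 0\<close>] unfolding LNA_def
      by (subst norm_minus_commute[of _ xs]) blast
    from C[OF _ this] show ?thesis
      using \<open>C > 0\<close> by simp
  qed
  obtain \<epsilon> where "\<epsilon> > 0"
    and conv: "\<And>x. newton_sequence F \<A> x \<Longrightarrow> norm (x 1 - xs) < \<epsilon> \<Longrightarrow> x \<longlonglongrightarrow> xs"
    using newton_sequence_locally_convergent[OF step[of "1 / 2"]] by auto
  have "(\<lambda>k. norm (x (Suc k) - xs)) \<in> o(\<lambda>k. norm (x k - xs))"
    if "newton_sequence F \<A> x" and "x \<longlonglongrightarrow> xs" for x
  proof (rule landau_o.smallI)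
    fix c :: real assume "c > 0"
    show "\<forall>\<^sub>F k in sequentially. norm (norm (x (Suc k) - xs)) \<le> c * norm (norm (x k - xs))"
      using newton_sequence_eventually_bound[OF that step[OF \<open>c > 0\<close>]] by simp
  qed
  with \<open>\<epsilon> > 0\<close> conv show ?thesis
    unfolding locally_superlinearly_convergent_def by blast
qed

lemma strong_LNA_imp_LNA:
  fixes F :: "real ^ 'n \<Rightarrow> real ^ 'n"
  assumes "strong_LNA F \<A> x"
  shows "LNA F \<A> x"
proof -
  from assms obtain C where C: "\<forall>\<^sub>F y in at x. \<forall>A\<in>\<A> y.
      norm (F x - F y - A *v (x - y)) \<le> C * (norm (x - y))\<^sup>2"
    unfolding strong_LNA_def by blast
  have "\<forall>\<^sub>F y in at x. \<forall>A\<in>\<A> y. norm (F x - F y - A *v (x - y)) \<le> c * norm (x - y)"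
    if "c > 0" for c
  proof -
    have "((\<lambda>y. C * norm (x - y)) \<longlongrightarrow> C * norm (x - x)) (at x)"
      by (intro tendsto_intros)
    then have "\<forall>\<^sub>F y in at x. C * norm (x - y) < c"
      using \<open>c > 0\<close> by (intro order_tendstoD(2)) simp_all
    with C show ?thesis
    proof eventually_elim
      case (elim y)
      have "C * (norm (x - y))\<^sup>2 \<le> c * norm (x - y)"
        using mult_right_mono[OF less_imp_le[OF elim(2)], of "norm (x - y)"]
        by (simp add: power2_eq_square mult.assoc)
      with elim(1) show ?case
        using order_trans by blast
    qed
  qed
  with assms show ?thesis
    unfolding LNA_def strong_LNA_def by blast
qed

theorem newton_locally_quadratic:
  fixes F :: "real ^ 'n \<Rightarrow> real ^ 'n"
  assumes "strong_LNA F \<A> xs" and "\<And>A. A \<in> \<A> xs \<Longrightarrow> invertible A" and "F xs = 0"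
  shows "locally_quadratically_convergent {x. newton_sequence F \<A> x} xs"
proof -
  have cpt: "compact (\<A> xs)" and usc: "usc_at \<A> xs"
    using assms(1) unfolding strong_LNA_def by blast+
  obtain C where C: "\<And>e :: real ^ 'n \<Rightarrow> real. e xs \<ge> 0 \<Longrightarrow>
       \<forall>\<^sub>F y in at xs. \<forall>A\<in>\<A> y. norm (F xs - F y - A *v (xs - y)) \<le> e y \<Longrightarrow>
       \<forall>\<^sub>F y in nhds xs. \<forall>A\<in>\<A> y. norm (y - matrix_inv A *v F y - xs) \<le> C * e y"
    using newton_step_bound[of \<A> xs F, OF cpt usc assms(2,3)] by blast
  from assms(1) obtain D where "\<forall>\<^sub>F y in at xs. \<forall>A\<in>\<A> y.
      norm (F xs - F y - A *v (xs - y)) \<le> D * (norm (y - xs))\<^sup>2"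
    unfolding strong_LNA_def by (auto simp: norm_minus_commute[of xs])
  from C[OF _ this] have step: "\<forall>\<^sub>F y in nhds xs. \<forall>A\<in>\<A> y.
      norm (y - matrix_inv A *v F y - xs) \<le> C * (D * (norm (y - xs))\<^sup>2)"
    by simp
  have "locally_superlinearly_convergent {x. newton_sequence F \<A> x} xs"
    using newton_locally_superlinear strong_LNA_imp_LNA assms by blast
  then obtain \<epsilon> where "\<epsilon> > 0"
    and conv: "\<And>x. newton_sequence F \<A> x \<Longrightarrow> norm (x 1 - xs) < \<epsilon> \<Longrightarrow> x \<longlonglongrightarrow> xs"
    unfolding locally_superlinearly_convergent_def by blast
  have "(\<lambda>k. norm (x (Suc k) - xs)) \<in> O(\<lambda>k. (norm (x k - xs))\<^sup>2)"
    if "newton_sequence F \<A> x" and "x \<longlonglongrightarrow> xs" for x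
    by (rule bigoI[of _ "C * D"])
      (use newton_sequence_eventually_bound[OF that step] in \<open>simp add: mult.assoc\<close>)
  with \<open>\<epsilon> > 0\<close> conv show ?thesis
    unfolding locally_quadratically_convergent_def by blast
qed

section \<open>The minimizer is a zero of the proximal residual\<close>

lemma differentiable_GDERIV_gradient:
  fixes f :: "real ^ 'n \<Rightarrow> real"
  assumes "f differentiable at x"
  shows "GDERIV f x :> gradient f x"
proof -
  from assms obtain f' where f': "(f has_derivative f') (at x)"
    unfolding differentiable_def by blast
  then have "linear f'"
    by (rule has_derivative_linear)
  then have "f' = (\<lambda>h. h \<bullet> adjoint f' 1)"
    using adjoint_works[of f' _ 1] by (auto simp: fun_eq_iff)
  then have "GDERIV f x :> adjoint f' 1"
    using f' unfolding gderiv_def by simp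
  moreover from this have "D = adjoint f' 1" if "GDERIV f x :> D" for D
    using has_derivative_unique[of f] that unfolding gderiv_def
    by (metis (no_types, lifting) vector_eq_ldot)
  ultimately show ?thesis
    unfolding gradient_def by (rule theI)
qed

text \<open>On the segment from the minimizer to \<open>y\<close>, convexity replaces \<open>g\<close> by its chord.  The
  resulting function of \<open>t\<close> is differentiable at \<open>0\<close> and is never below its value there, so its
  derivative at \<open>0\<close> is nonnegative.\<close>

lemma minimizer_variational_inequality:
  fixes f :: "real ^ 'n \<Rightarrow> real"
  assumes D: "GDERIV f xs :> D" and g: "closed_convex_function g"
    and xs_min: "is_arg_min (\<lambda>x. ereal (f x) + g x) (\<lambda>_. True) xs"
    and a: "g xs = ereal a" and b: "g y = ereal b"
  shows "a \<le> b + D \<bullet> (y - xs)"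
proof (rule ccontr)
  assume neg: "\<not> ?thesis"
  define \<psi> where "\<psi> t = f (xs + t *\<^sub>R (y - xs)) + t * (b - a)" for t :: real
  have "((\<lambda>t. xs + t *\<^sub>R (y - xs)) has_derivative (\<lambda>t. t *\<^sub>R (y - xs))) (at 0)"
    by (auto intro!: derivative_eq_intros)
  moreover have "(f has_derivative (\<lambda>h. h \<bullet> D)) (at (xs + 0 *\<^sub>R (y - xs)))"
    using D by (simp add: gderiv_def)
  ultimately have "((\<lambda>t. f (xs + t *\<^sub>R (y - xs))) has_derivative (\<lambda>t. (t *\<^sub>R (y - xs)) \<bullet> D)) (at 0)"
    by (rule has_derivative_compose)
  then have "((\<lambda>t. f (xs + t *\<^sub>R (y - xs))) has_real_derivative D \<bullet> (y - xs)) (at 0)"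
    unfolding has_field_derivative_def by (simp add: inner_commute mult.commute[of _ "D \<bullet> _"])
  then have "(\<psi> has_real_derivative D \<bullet> (y - xs) + (b - a)) (at 0)"
    unfolding \<psi>_def by (auto intro!: derivative_eq_intros)
  moreover have "D \<bullet> (y - xs) + (b - a) < 0"
    using neg by simp
  ultimately obtain d where "d > 0" and dec: "\<And>h. h > 0 \<Longrightarrow> h < d \<Longrightarrow> \<psi> (0 + h) < \<psi> 0"
    using DERIV_neg_dec_right by blast
  define t where "t = min 1 (d / 2)"
  have t: "0 < t" "t \<le> 1" "t < d"
    using \<open>d > 0\<close> by (auto simp: t_def)
  let ?p = "(1 - t) *\<^sub>R xs + t *\<^sub>R y"
  have "g ?p \<le> ereal (1 - t) * g xs + ereal t * g y"
    using g t unfolding closed_convex_function_def by simp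
  then have "ereal (f ?p) + g ?p \<le> ereal (f ?p) + ereal ((1 - t) * a + t * b)"
    by (intro add_left_mono) (simp add: a b)
  moreover have "ereal (f xs) + g xs \<le> ereal (f ?p) + g ?p"
    using xs_min by (simp add: is_arg_min_linorder)
  ultimately have "ereal (f xs) + g xs \<le> ereal (f ?p) + ereal ((1 - t) * a + t * b)"
    by (rule order_trans[rotated])
  then have "f xs + a \<le> f ?p + ((1 - t) * a + t * b)"
    by (simp add: a)
  moreover have "?p = xs + t *\<^sub>R (y - xs)"
    by (simp add: algebra_simps)
  ultimately have "\<psi> 0 \<le> \<psi> t"
    by (simp add: \<psi>_def algebra_simps)
  with dec[of t] t show False by simp
qed

lemma closed_convex_minimizer_finite:
  fixes f :: "real ^ 'n \<Rightarrow> real"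
  assumes g: "closed_convex_function g"
    and "is_arg_min (\<lambda>x. ereal (f x) + g x) (\<lambda>_. True) xs"
  obtains a where "g xs = ereal a"
proof -
  from g obtain y where "g y \<noteq> \<infinity>"
    unfolding closed_convex_function_def by blast
  moreover have "ereal (f xs) + g xs \<le> ereal (f y) + g y"
    using assms(2) by (simp add: is_arg_min_linorder)
  ultimately have "g xs \<noteq> \<infinity>"
    by auto
  moreover have "g xs \<noteq> - \<infinity>"
    using g unfolding closed_convex_function_def by blast
  ultimately show thesis
    using that by (cases "g xs") auto
qed

text \<open>\<^const>\<open>prox\<close> selects some minimizer, so a strict global minimizer is the value selected.\<close>

lemma prox_eqI:
  assumes "\<And>y. y \<noteq> p \<Longrightarrow>
    h p + ereal (1 / 2 * (norm (p - x))\<^sup>2) < h y + ereal (1 / 2 * (norm (y - x))\<^sup>2)"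
  shows "prox h x = p"
  unfolding prox_def arg_min_def
proof (rule some_equality)
  show "is_arg_min (\<lambda>y. h y + ereal (1 / 2 * (norm (y - x))\<^sup>2)) (\<lambda>_. True) p"
    unfolding is_arg_min_def using assms by (metis less_asym less_irrefl)
next
  fix q assume "is_arg_min (\<lambda>y. h y + ereal (1 / 2 * (norm (y - x))\<^sup>2)) (\<lambda>_. True) q"
  then show "q = p"
    unfolding is_arg_min_def using assms by metis
qed

lemma prox_residual_minimizer:
  fixes f :: "real ^ 'n \<Rightarrow> real"
  assumes "f differentiable at xs" and g: "closed_convex_function g" and "\<nu> > 0"
    and xs_min: "is_arg_min (\<lambda>x. ereal (f x) + g x) (\<lambda>_. True) xs"
  shows "prox_residual f g \<nu> xs = 0"
proof -
  let ?D = "gradient f xs"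
  let ?w = "xs - \<nu> *\<^sub>R ?D"
  obtain a where a: "g xs = ereal a"
    using closed_convex_minimizer_finite[OF g xs_min] .
  have "prox (\<lambda>y. ereal \<nu> * g y) ?w = xs"
  proof (rule prox_eqI)
    fix y assume "y \<noteq> xs"
    show "ereal \<nu> * g xs + ereal (1 / 2 * (norm (xs - ?w))\<^sup>2)
        < ereal \<nu> * g y + ereal (1 / 2 * (norm (y - ?w))\<^sup>2)"
    proof (cases "g y")
      case (real b)
      have "a \<le> b + ?D \<bullet> (y - xs)"
        using minimizer_variational_inequality[OF _ g xs_min a real]
          differentiable_GDERIV_gradient[OF assms(1)] by blast
      then have "\<nu> * a \<le> \<nu> * (b + ?D \<bullet> (y - xs))"
        using \<open>\<nu> > 0\<close> by simp
      moreover have "(norm (y - ?w))\<^sup>2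
          = (norm (y - xs))\<^sup>2 + 2 * (\<nu> * (?D \<bullet> (y - xs))) + (norm (xs - ?w))\<^sup>2"
        unfolding power2_norm_eq_inner
        by (simp add: inner_diff_left inner_diff_right inner_commute algebra_simps)
      moreover have "(norm (y - xs))\<^sup>2 > 0"
        using \<open>y \<noteq> xs\<close> by simp
      ultimately have "\<nu> * a + 1 / 2 * (norm (xs - ?w))\<^sup>2 < \<nu> * b + 1 / 2 * (norm (y - ?w))\<^sup>2"
        unfolding distrib_left by linarith
      then show ?thesis
        by (simp add: a real)
    next
      case PInf
      then show ?thesis
        using \<open>\<nu> > 0\<close> by (simp add: a)
    next
      case MInf
      then show ?thesis
        using g unfolding closed_convex_function_def by blast
    qed
  qed
  then show ?thesis
    by (simp add: prox_residual_def)
qed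

section \<open>Local convergence of the linear Newton method\<close>

lemma linear_newton_sequence_imp_newton_sequence:
  assumes "linear_newton_sequence f g \<nu> x"
  shows "newton_sequence (prox_residual f g \<nu>) (prox_residual_subdiff f g \<nu>) x"
  using assms unfolding linear_newton_sequence_def newton_sequence_def prox_residual_subdiff_def
  by fastforce

theorem theorem1:
  fixes f :: "real ^ 'n \<Rightarrow> real" and g :: "real ^ 'n \<Rightarrow> ereal"
    and \<mu> \<nu> :: real and xstar :: "real ^ 'n"
  assumes "twice_differentiable f"
    and "\<mu> > 0" and "strongly_convex \<mu> f"
    and "closed_convex_function g"
    and "\<nu> > 0"
    and "is_arg_min (\<lambda>x. ereal (f x) + g x) (\<lambda>_. True) xstar"
    and "LNA (prox_residual f g \<nu>) (prox_residual_subdiff f g \<nu>) xstar"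
    and "\<And>x A. A \<in> prox_residual_subdiff f g \<nu> x \<Longrightarrow> invertible A"
  shows "locally_superlinearly_convergent {x. linear_newton_sequence f g \<nu> x} xstar \<and>
     (strong_LNA (prox_residual f g \<nu>) (prox_residual_subdiff f g \<nu>) xstar \<longrightarrow>
        locally_quadratically_convergent {x. linear_newton_sequence f g \<nu> x} xstar)"
proof -
  let ?F = "prox_residual f g \<nu>" and ?\<A> = "prox_residual_subdiff f g \<nu>"
  have sub: "{x. linear_newton_sequence f g \<nu> x} \<subseteq> {x. newton_sequence ?F ?\<A> x}"
    using linear_newton_sequence_imp_newton_sequence by blast
  have "f differentiable at xstar"
    using assms(1) unfolding twice_differentiable_def by blast
  then have zero: "?F xstar = 0"
    using prox_residual_minimizer assms(4-6) by blast
  have "locally_superlinearly_convergent {x. newton_sequence ?F ?\<A> x} xstar"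
    using newton_locally_superlinear assms(7,8) zero by blast
  then have "locally_superlinearly_convergent {x. linear_newton_sequence f g \<nu> x} xstar"
    using sub unfolding locally_superlinearly_convergent_def by blast
  moreover have "locally_quadratically_convergent {x. linear_newton_sequence f g \<nu> x} xstar"
    if "strong_LNA ?F ?\<A> xstar"
  proof -
    have "locally_quadratically_convergent {x. newton_sequence ?F ?\<A> x} xstar"
      using newton_locally_quadratic that assms(8) zero by blast
    then show ?thesis
      using sub unfolding locally_quadratically_convergent_def by blast
  qed
  ultimately show ?thesis by blast
qed

end
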